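(* Let $P$ be a finite poset, $\varepsilon>0$ and $j\in\{1,2\}$. Then for all sufficiently large $n$, \[ M_j(P,n)\ge \frac{1}{t_j(P)}\binom{n}{\lfloor n/2\rfloor}(1-\varepsilon). \]
   Context: $B_n$ denotes the poset of all subsets of $[n]$ ordered by inclusion. For a finite poset $(P,<_p)$, an embedding $f:P\to B_n$ is an injective map with $f(a)\subset f(b)$ whenever $a<_p b$; an induced embedding is an injective map with $f(a)\subset f(b)$ if and only if $a<_p b$. Two sets $X,Y$ of subsets of $[n]$ are incomparable if there are no $x\in X$, $y\in Y$ with $x\subseteq y$ or $y\subseteq x$; a family of sets of subsets is incomparable if its members are pairwise incomparable. $M_1(P,n)$ (resp. $M_2(P,n)$) is the largest $M$ such that there exist embeddings (resp. induced embeddings) $f_1,\dots,f_M:P\to B_n$ with $\{\mathrm{Im}(f_i)\}_{i=1}^M$ an incomparable family. For $F\subseteq B_n$, $\mathrm{conv}(F)=\{b\in B_n:\exists a,c\in F,\ a\subseteq b\subseteq c\}$. $t_1(P)$ (resp. $t_2(P)$) is the minimum of $|\mathrm{conv}(\mathrm{Im}(f))|$ over all $n$ and all embeddings (resp. induced embeddings) $f:P\to B_n$. *)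

theory Defs
  imports Complex_Main
begin

text \<open>
  The Boolean lattice \<open>B\<^sub>n\<close> is \<^term>\<open>Pow {1..n} :: nat set set\<close>. A poset is a carrier \<open>P\<close> with a
  reflexive order \<open>r\<close> such that \<^term>\<open>partial_order_on P r\<close>; its strict part
  \<open>a <\<^sub>p b\<close> is \<^term>\<open>(a, b) \<in> r \<and> a \<noteq> b\<close>. Throughout, \<open>\<subset>\<close> is proper inclusion.
\<close>

definition embedding :: "'a set \<Rightarrow> 'a rel \<Rightarrow> nat \<Rightarrow> ('a \<Rightarrow> nat set) \<Rightarrow> bool" where
  "embedding P r n f \<longleftrightarrow>
     f ` P \<subseteq> Pow {1..n} \<and> inj_on f P \<and>
     (\<forall>a\<in>P. \<forall>b\<in>P. (a, b) \<in> r \<and> a \<noteq> b \<longrightarrow> f a \<subset> f b)"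

definition induced_embedding :: "'a set \<Rightarrow> 'a rel \<Rightarrow> nat \<Rightarrow> ('a \<Rightarrow> nat set) \<Rightarrow> bool" where
  "induced_embedding P r n f \<longleftrightarrow>
     f ` P \<subseteq> Pow {1..n} \<and> inj_on f P \<and>
     (\<forall>a\<in>P. \<forall>b\<in>P. f a \<subset> f b \<longleftrightarrow> (a, b) \<in> r \<and> a \<noteq> b)"

definition incomparable :: "nat set set \<Rightarrow> nat set set \<Rightarrow> bool" where
  "incomparable X Y \<longleftrightarrow> \<not> (\<exists>x\<in>X. \<exists>y\<in>Y. x \<subseteq> y \<or> y \<subseteq> x)"

text \<open>
  Incomparability is required of the images at any two distinct indices, so that repeating an
  embedding of a nonempty poset is not allowed. For nonempty \<open>P\<close> the images are then disjoint
  nonempty subsets of \<open>B\<^sub>n\<close>, so \<open>M \<le> 2\<^sup>n\<close> and the maximum is over a finite set, which contains 0.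
\<close>

definition M1 :: "'a set \<Rightarrow> 'a rel \<Rightarrow> nat \<Rightarrow> nat" where
  "M1 P r n = Max {M. \<exists>f :: nat \<Rightarrow> 'a \<Rightarrow> nat set.
     (\<forall>i\<in>{1..M}. embedding P r n (f i)) \<and>
     (\<forall>i\<in>{1..M}. \<forall>k\<in>{1..M}. i \<noteq> k \<longrightarrow> incomparable (f i ` P) (f k ` P))}"

definition M2 :: "'a set \<Rightarrow> 'a rel \<Rightarrow> nat \<Rightarrow> nat" where
  "M2 P r n = Max {M. \<exists>f :: nat \<Rightarrow> 'a \<Rightarrow> nat set.
     (\<forall>i\<in>{1..M}. induced_embedding P r n (f i)) \<and>
     (\<forall>i\<in>{1..M}. \<forall>k\<in>{1..M}. i \<noteq> k \<longrightarrow> incomparable (f i ` P) (f k ` P))}"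

definition conv :: "nat \<Rightarrow> nat set set \<Rightarrow> nat set set" where
  "conv n F = {b \<in> Pow {1..n}. \<exists>a\<in>F. \<exists>c\<in>F. a \<subseteq> b \<and> b \<subseteq> c}"

definition t1 :: "'a set \<Rightarrow> 'a rel \<Rightarrow> nat" where
  "t1 P r = (LEAST k. \<exists>n f. embedding P r n f \<and> k = card (conv n (f ` P)))"

definition t2 :: "'a set \<Rightarrow> 'a rel \<Rightarrow> nat" where
  "t2 P r = (LEAST k. \<exists>n f. induced_embedding P r n f \<and> k = card (conv n (f ` P)))"

end

(* Let F be the convex hull of the image of an optimal embedding into B_k, and t = |F|. Write
   B_n = B_k x B_{n-k} and sort sets by their trace on the first k points. Over the traces in F
   place the copies X |-> X u A of F, with A of a fixed size in B_{n-k}; over every other trace H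
   place H u -, applied to a packing of B_{n-k} obtained recursively. All sets with a given trace
   are confined to a size window, and larger traces get lower windows, so that sets with different
   traces, not both in F, are incomparable. Every size used is within O(1) of n/2, where the
   binomial coefficients are asymptotic to the central one, so a packing density c is improved to
   (1 + (2^k - t) c) / 2^k; iterating from 0 tends to the fixed point 1/t. *)

theory Submission
  imports Defs
begin

section \<open>Packings of copies of a convex family\<close>

text \<open>Copies are kept as maps on \<open>F\<close> rather than as image sets, so that they can
  be composed with an embedding of the poset. The last clause makes different copies incomparable,
  both directions being covered because \<open>\<phi>\<close> and \<open>\<psi>\<close> may be
  swapped. For nonempty \<open>F\<close> it also makes their images disjoint, so
  \<open>card S\<close> really counts copies.\<close>

definition packing :: "nat set set \<Rightarrow> nat \<Rightarrow> int \<Rightarrow> int \<Rightarrow> (nat set \<Rightarrow> nat set) set \<Rightarrow> bool" where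
  "packing F n lo hi S \<longleftrightarrow> finite S \<and>
     (\<forall>\<phi>\<in>S. \<forall>X\<in>F. \<phi> X \<subseteq> {1..n} \<and> lo \<le> int (card (\<phi> X)) \<and> int (card (\<phi> X)) \<le> hi) \<and>
     (\<forall>\<phi>\<in>S. \<forall>X\<in>F. \<forall>Y\<in>F. \<phi> X \<subseteq> \<phi> Y \<longleftrightarrow> X \<subseteq> Y) \<and>
     (\<forall>\<phi>\<in>S. \<forall>\<psi>\<in>S. \<forall>X\<in>F. \<forall>Y\<in>F. \<phi> X \<subseteq> \<psi> Y \<longrightarrow> \<phi> = \<psi>)"

text \<open>The order of quantifiers matters: the window width \<open>D\<close> is fixed before
  \<open>Z\<close> and \<open>\<delta>\<close>, and from some \<open>n\<close> on every top
  \<open>T\<close> within \<open>Z / 2\<close> of \<open>n / 2\<close> has to work. This uniformity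
  lets the recursion ask for packings with shifted tops.\<close>

definition packing_density :: "nat set set \<Rightarrow> real \<Rightarrow> bool" where
  "packing_density F c \<longleftrightarrow> (\<exists>D. \<forall>Z. \<forall>\<delta>>0. \<forall>\<^sub>F n in sequentially. \<forall>T::int. \<bar>2 * T - int n\<bar> \<le> Z \<longrightarrow>
     (\<exists>S. packing F n (T - D) T S \<and> real (card S) \<ge> (c - \<delta>) * real (n choose (n div 2))))"

lemma packingD:
  assumes "packing F n lo hi S"
  shows "finite S"
    and "\<phi> \<in> S \<Longrightarrow> X \<in> F \<Longrightarrow> \<phi> X \<subseteq> {1..n}"
    and "\<phi> \<in> S \<Longrightarrow> X \<in> F \<Longrightarrow> lo \<le> int (card (\<phi> X))"
    and "\<phi> \<in> S \<Longrightarrow> X \<in> F \<Longrightarrow> int (card (\<phi> X)) \<le> hi"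
    and "\<phi> \<in> S \<Longrightarrow> X \<in> F \<Longrightarrow> Y \<in> F \<Longrightarrow> \<phi> X \<subseteq> \<phi> Y \<longleftrightarrow> X \<subseteq> Y"
    and "\<phi> \<in> S \<Longrightarrow> \<psi> \<in> S \<Longrightarrow> X \<in> F \<Longrightarrow> Y \<in> F \<Longrightarrow> \<phi> X \<subseteq> \<psi> Y \<Longrightarrow> \<phi> = \<psi>"
proof -
  note * = assms[unfolded packing_def]
  show "finite S" using * by (rule conjunct1)
  note ** = *[THEN conjunct2, THEN conjunct1, THEN bspec, THEN bspec]
  show "\<phi> \<in> S \<Longrightarrow> X \<in> F \<Longrightarrow> \<phi> X \<subseteq> {1..n}" using ** by (rule conjunct1)
  show "\<phi> \<in> S \<Longrightarrow> X \<in> F \<Longrightarrow> lo \<le> int (card (\<phi> X))" using **[THEN conjunct2] by (rule conjunct1)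
  show "\<phi> \<in> S \<Longrightarrow> X \<in> F \<Longrightarrow> int (card (\<phi> X)) \<le> hi" using **[THEN conjunct2] by (rule conjunct2)
  show "\<phi> \<in> S \<Longrightarrow> X \<in> F \<Longrightarrow> Y \<in> F \<Longrightarrow> \<phi> X \<subseteq> \<phi> Y \<longleftrightarrow> X \<subseteq> Y"
    by (rule *[THEN conjunct2, THEN conjunct2, THEN conjunct1, THEN bspec, THEN bspec, THEN bspec])
  show "\<phi> \<in> S \<Longrightarrow> \<psi> \<in> S \<Longrightarrow> X \<in> F \<Longrightarrow> Y \<in> F \<Longrightarrow> \<phi> X \<subseteq> \<psi> Y \<Longrightarrow> \<phi> = \<psi>"
    by (rule *[THEN conjunct2, THEN conjunct2, THEN conjunct2, THEN bspec, THEN bspec, THEN bspec, THEN bspec, THEN mp])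
qed

section \<open>Binomial coefficients near the middle\<close>

text \<open>The coefficients at \<open>m = n div 2 + d\<close> and at \<open>m + 1\<close> have
  quotient \<open>(n - m) / (m + 1)\<close>, which tends to 1.\<close>

lemma central_binomial_ratio:
  "(\<lambda>n. real (n choose (n div 2 + d)) / real (n choose (n div 2))) \<longlonglongrightarrow> 1"
proof (induction d)
  case 0
  have "(\<lambda>n. real (n choose (n div 2)) / real (n choose (n div 2))) = (\<lambda>n. 1)"
    by (auto simp: binomial_eq_0_iff)
  then show ?case by simp
next
  case (Suc d)
  have step: "real (n choose (n div 2 + Suc d)) =
      real (n choose (n div 2 + d)) * ((real n - real (n div 2 + d)) / real (Suc (n div 2 + d)))"
    if "n \<ge> 2 * d" for n
  proof -
    have le: "n div 2 + d \<le> n" using that by linarith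
    have "Suc (n div 2 + d) * (n choose Suc (n div 2 + d)) = (n - (n div 2 + d)) * (n choose (n div 2 + d))"
      using binomial_absorb_comp[of n "n div 2 + d"] binomial_absorption[of "n div 2 + d" n]
      by simp
    then have "real (Suc (n div 2 + d)) * real (n choose Suc (n div 2 + d))
        = (real n - real (n div 2 + d)) * real (n choose (n div 2 + d))"
      using le by (metis of_nat_mult of_nat_diff)
    then show ?thesis by (simp add: field_simps)
  qed
  have q: "(\<lambda>n. (real n - real (n div 2 + d)) / real (Suc (n div 2 + d))) \<longlonglongrightarrow> 1"
  proof (rule tendsto_sandwich)
    show "\<forall>\<^sub>F n in sequentially. 1 - (4 * real d + 2) * (1 / real n)
        \<le> (real n - real (n div 2 + d)) / real (Suc (n div 2 + d))"
    proof (rule eventually_sequentiallyI[of 1])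
      fix n :: nat assume n: "1 \<le> n"
      define h where "h = real (n div 2)"
      have "n \<le> 2 * (n div 2) + 1" "2 * (n div 2) \<le> n" by linarith+
      then have h: "real n \<le> 2 * h + 1" "2 * h \<le> real n"
        unfolding h_def by linarith+
      \<comment> \<open>Since \<open>n\<close> lies between \<open>2 * h\<close> and
        \<open>2 * h + 1\<close>, the quotient is at least
        \<open>1 - (2 * d + 1) / (h + d + 1)\<close>, and \<open>h + d + 1\<close> is at least
        \<open>n / 2\<close>.\<close>
      have "1 - (4 * real d + 2) * (1 / real n) \<le> 1 - (2 * real d + 1) / (h + real d + 1)"
      proof -
        have "(2 * real d + 1) / (h + real d + 1) \<le> (2 * real d + 1) / (real n / 2)"
          using h n by (intro divide_left_mono) (auto intro!: mult_pos_pos)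
        then show ?thesis by (simp add: field_simps)
      qed
      also have "\<dots> = (h - real d) / (h + real d + 1)"
      proof -
        have "h + real d + 1 > 0" using h n by linarith
        then show ?thesis by (simp add: field_simps)
      qed
      also have "\<dots> \<le> (real n - (h + real d)) / (h + real d + 1)"
        using h n by (intro divide_right_mono) auto
      finally show "1 - (4 * real d + 2) * (1 / real n)
          \<le> (real n - real (n div 2 + d)) / real (Suc (n div 2 + d))"
        by (simp add: h_def add_ac)
    qed
    show "\<forall>\<^sub>F n in sequentially. (real n - real (n div 2 + d)) / real (Suc (n div 2 + d)) \<le> 1"
    proof (rule always_eventually, rule allI)
      fix n :: nat
      have "n \<le> 2 * (n div 2) + 1" by linarith
      then have "real n \<le> 2 * real (n div 2) + 1" by linarith
      then show "(real n - real (n div 2 + d)) / real (Suc (n div 2 + d)) \<le> 1"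
        by simp
    qed
    show "(\<lambda>n. 1 - (4 * real d + 2) * (1 / real n)) \<longlonglongrightarrow> 1"
      using tendsto_diff[OF tendsto_const[of "1::real"]
          tendsto_mult[OF tendsto_const[of "4 * real d + 2"] lim_1_over_n]] by simp
  qed simp
  have "(\<lambda>n. real (n choose (n div 2 + d)) / real (n choose (n div 2))
      * ((real n - real (n div 2 + d)) / real (Suc (n div 2 + d)))) \<longlonglongrightarrow> 1"
    using tendsto_mult[OF Suc q] by simp
  then show ?case
  proof (rule Lim_transform_eventually)
    show "\<forall>\<^sub>F n in sequentially. real (n choose (n div 2 + d)) / real (n choose (n div 2))
        * ((real n - real (n div 2 + d)) / real (Suc (n div 2 + d)))
        = real (n choose (n div 2 + Suc d)) / real (n choose (n div 2))"
      by (rule eventually_sequentiallyI[of "2 * d"]) (simp only: step times_divide_eq_left)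
  qed
qed

text \<open>Pascal's rule splits a central coefficient into two of the previous row, neither above
  the central one there, so lowering \<open>n\<close> by one costs at most a factor 2. Truncated
  subtraction keeps this true at 0.\<close>

lemma central_binomial_half: "n choose (n div 2) \<le> 2 ^ k * ((n - k) choose ((n - k) div 2))"
proof (induction k)
  case (Suc k)
  have *: "m choose (m div 2) \<le> 2 * ((m - 1) choose ((m - 1) div 2))" for m :: nat
  proof (cases m)
    case (Suc l)
    show ?thesis
    proof (cases "Suc l div 2")
      case (Suc j)
      then have "Suc l choose (Suc l div 2) = (l choose j) + (l choose Suc j)" by simp
      also have "\<dots> \<le> 2 * (l choose (l div 2))"
        using binomial_maximum[of l j] binomial_maximum[of l "Suc j"] by simp
      finally show ?thesis using \<open>m = Suc l\<close> by simp
    qed (use Suc in simp)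
  qed simp
  have "n choose (n div 2) \<le> 2 ^ k * ((n - k) choose ((n - k) div 2))" by (rule Suc)
  also have "\<dots> \<le> 2 ^ k * (2 * ((n - k - 1) choose ((n - k - 1) div 2)))"
    using *[of "n - k"] by simp
  finally show ?case by simp
qed simp

text \<open>Symmetry moves \<open>T\<close> to the upper half, where the coefficients decrease. The
  single coefficient at \<open>n div 2 + d\<close> then bounds all of them from below, so one limit
  serves every \<open>T\<close> at once.\<close>

lemma near_central_binomial:
  assumes "\<delta> > 0"
  shows "\<forall>\<^sub>F n in sequentially. \<forall>T::int. \<bar>2 * T - int n\<bar> \<le> Z \<longrightarrow>
     0 \<le> T \<and> real (n choose nat T) \<ge> (1 - \<delta>) * real (n choose (n div 2))"
proof -
  \<comment> \<open>The summand 1 gives \<open>Z < int d\<close> and absorbs the rounding in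
    \<open>n div 2\<close>.\<close>
  define d where "d = nat Z + 1"
  have "\<forall>\<^sub>F n in sequentially. real (n choose (n div 2 + d)) / real (n choose (n div 2)) > 1 - \<delta>"
    by (rule order_tendstoD[OF central_binomial_ratio]) (use assms in simp)
  moreover have "\<forall>\<^sub>F n in sequentially. n \<ge> 2 * d + 2" by (rule eventually_ge_at_top)
  ultimately show ?thesis
  proof eventually_elim
    case (elim n)
    show ?case
    proof (intro allI impI)
      fix T :: int assume T: "\<bar>2 * T - int n\<bar> \<le> Z"
      have d: "Z < int d" "int n \<ge> 2 * int d + 2"
        using elim(2) by (simp add: d_def, linarith)
      have T0: "0 \<le> T" "nat T \<le> n" using T d by linarith+
      \<comment> \<open>\<open>U\<close> is whichever of \<open>T\<close> and its mirror image
        \<open>n - T\<close> lies in the upper half.\<close>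
      define U where "U = max (nat T) (n - nat T)"
      have U: "n choose U = n choose nat T"
        using binomial_symmetric[OF T0(2)] by (auto simp: U_def max_def)
      have "n div 2 \<le> U" "U \<le> n div 2 + d" "n div 2 + d \<le> n" "n div 2 \<le> n"
      proof -
        have "U = nat T \<or> U = n - nat T" "nat T \<le> U" "n - nat T \<le> U" by (auto simp: U_def)
        moreover have "2 * nat T \<le> n + d" "n \<le> 2 * nat T + d" using T T0 d by linarith+
        moreover have "2 * d + 2 \<le> n" using elim(2) .
        ultimately show "n div 2 \<le> U" "U \<le> n div 2 + d" "n div 2 + d \<le> n" "n div 2 \<le> n"
          by linarith+
      qed
      then have "n choose (n div 2 + d) \<le> n choose U"
        using binomial_antimono[of U "n div 2 + d" n] by linarith
      then have "real (n choose (n div 2 + d)) \<le> real (n choose nat T)" using U by simp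
      moreover have "(1 - \<delta>) * real (n choose (n div 2)) \<le> real (n choose (n div 2 + d))"
        using elim(1) \<open>n div 2 \<le> n\<close> by (simp add: field_simps zero_less_binomial)
      ultimately show "0 \<le> T \<and> real (n choose nat T) \<ge> (1 - \<delta>) * real (n choose (n div 2))"
        using T0 by linarith
    qed
  qed
qed

section \<open>Ranks of traces\<close>

text \<open>
  Ranks are constant on \<open>F\<close> and strictly increasing along every other proper inclusion; convexity
  of \<open>F\<close> is what makes this possible.
\<close>

definition trace_rank :: "nat set set \<Rightarrow> nat \<Rightarrow> nat set \<Rightarrow> nat" where
  "trace_rank F k H = (if H \<in> F then k + 1 else if \<exists>X\<in>F. H \<subseteq> X then card H else k + 2 + card H)"

text \<open>Sets properly below a member of \<open>F\<close> have rank at most \<open>k\<close>,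
  members have \<open>k + 1\<close>, all others at least \<open>k + 2\<close>. Being below a member
  passes to subsets, and by convexity a set outside \<open>F\<close> that contains a member is below
  none, so the level never drops. Within the two outer levels cardinality decides.\<close>

lemma trace_rank_less:
  assumes convex: "\<And>X Y Z. X \<in> F \<Longrightarrow> Z \<in> F \<Longrightarrow> X \<subseteq> Y \<Longrightarrow> Y \<subseteq> Z \<Longrightarrow> Y \<in> F"
    and sub: "H \<subset> G" "G \<subseteq> {1..k}" and nF: "\<not> (H \<in> F \<and> G \<in> F)"
  shows "trace_rank F k H < trace_rank F k G"
proof -
  have "finite G" using sub(2) finite_subset by blast
  then have lt: "card H < card G" using sub(1) psubset_card_mono by blast
  have "card G \<le> k" using card_mono[OF _ sub(2)] by simp
  moreover have "\<exists>X\<in>F. H \<subseteq> X" if "\<exists>X\<in>F. G \<subseteq> X" using that sub(1) by blast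
  moreover have "\<not> (\<exists>X\<in>F. G \<subseteq> X)" if "H \<in> F" using that nF sub(1) convex[of H _ G] by blast
  moreover have "\<exists>X\<in>F. H \<subseteq> X" if "G \<in> F" using that sub(1) by blast
  ultimately show ?thesis using lt nF unfolding trace_rank_def by auto
qed

lemma trace_rank_le:
  assumes "H \<subseteq> {1..k}"
  shows "trace_rank F k H \<le> 2 * k + 2"
  using card_mono[OF _ assms] by (auto simp: trace_rank_def)

section \<open>The product construction\<close>

text \<open>The size window is cut into pieces of width \<open>D\<close>: rank \<open>r\<close>
  receives the sizes from \<open>T - (r + 1) * D\<close> to \<open>T - r * D\<close>. The windows of
  the \<open>S H\<close> are lowered by \<open>card H\<close>, since adjoining \<open>H\<close> adds
  that many points. The value of \<open>a\<close> puts all sizes \<open>card X + a\<close> into the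
  piece of rank \<open>k + 1\<close>; their spread of at most \<open>k\<close> fits because
  \<open>D \<ge> int k\<close>.\<close>

lemma packing_step:
  assumes F: "F \<subseteq> Pow {1..k}" "F \<noteq> {}"
    and convex: "\<And>X Y Z. X \<in> F \<Longrightarrow> Z \<in> F \<Longrightarrow> X \<subseteq> Y \<Longrightarrow> Y \<subseteq> Z \<Longrightarrow> Y \<in> F"
    and nk: "n \<ge> k" and D: "D \<ge> int k" and a: "int a = T - (int k + 1) * D - int k"
    and holes: "\<And>H. H \<in> Pow {1..k} - F \<Longrightarrow>
      packing F (n - k) (T - int (trace_rank F k H) * D - int (card H) - D)
        (T - int (trace_rank F k H) * D - int (card H)) (S H)"
  shows "\<exists>S'. packing F n (T - (2 * int k + 3) * D) T S' \<and>
    card S' = (\<Sum>H\<in>Pow {1..k} - F. card (S H)) + ((n - k) choose a)"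
proof -
  \<comment> \<open>\<open>sh\<close> moves subsets of \<open>{1..n-k}\<close> to the points after
    \<open>k\<close>, and \<open>tr\<close> reads off the part in \<open>{1..k}\<close>.
    \<open>ext\<close> puts a recursive copy over the hole \<open>H\<close>; \<open>base\<close>
    puts \<open>F\<close> itself over a fixed \<open>A\<close>.\<close>
  define sh where "sh = (\<lambda>A. (\<lambda>x. x + k) ` A :: nat set)"
  define ext where "ext = (\<lambda>H (\<phi> :: nat set \<Rightarrow> nat set) X. H \<union> sh (\<phi> X))"
  define base where "base = (\<lambda>A X. X \<union> sh A)"
  define \<A> where "\<A> = {A. A \<subseteq> {1..n-k} \<and> card A = a}"
  define Hs where "Hs = Pow {1..k} - F"
  define S1 where "S1 = (\<lambda>H. ext H ` S H)"
  define S2 where "S2 = base ` \<A>"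
  define S' where "S' = (\<Union>H\<in>Hs. S1 H) \<union> S2"
  define tr where "tr = (\<lambda>x :: nat set. x \<inter> {1..k})"
  define \<rho> where "\<rho> = (\<lambda>H. int (trace_rank F k H))"

  have sh_sub: "sh A \<subseteq> {1..n} \<and> tr (sh A) = {}" if "A \<subseteq> {1..n-k}" for A
    using that nk unfolding sh_def tr_def by fastforce
  have sh_mono: "sh A \<subseteq> sh B \<longleftrightarrow> A \<subseteq> B" for A B unfolding sh_def by auto
  have sh_card: "card (sh A) = card A" for A unfolding sh_def by (simp add: card_image)
  have tr_union: "tr (H \<union> sh A) = H" if "H \<subseteq> {1..k}" "A \<subseteq> {1..n-k}" for H A
    using that sh_sub[of A] unfolding tr_def by blast
  have sub_union: "H \<union> sh A \<subseteq> G \<union> sh B \<longleftrightarrow> H \<subseteq> G \<and> A \<subseteq> B"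
    if "H \<subseteq> {1..k}" "A \<subseteq> {1..n-k}" "G \<subseteq> {1..k}" "B \<subseteq> {1..n-k}" for H A G B
    using that sh_sub[of A] sh_sub[of B] sh_mono[of A B] unfolding tr_def by blast
  have card_union: "card (H \<union> sh A) = card H + card A"
    if "H \<subseteq> {1..k}" "A \<subseteq> {1..n-k}" for H A
  proof -
    have "finite H" "finite (sh A)" using that finite_subset unfolding sh_def by blast+
    moreover have "H \<inter> sh A = {}" using that sh_sub[of A] unfolding tr_def by blast
    ultimately show ?thesis by (simp add: card_Un_disjoint sh_card)
  qed

  have k_n: "{1..k} \<subseteq> {1..n}" using nk by auto
  have hole: "H \<subseteq> {1..k}" "H \<notin> F" if "H \<in> Hs" for H using that by (auto simp: Hs_def)
  have pack: "packing F (n - k) (T - \<rho> H * D - int (card H) - D) (T - \<rho> H * D - int (card H)) (S H)"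
    if "H \<in> Hs" for H
    using holes that unfolding Hs_def \<rho>_def by blast
  have S_sub: "\<phi> X \<subseteq> {1..n-k}" if "H \<in> Hs" "\<phi> \<in> S H" "X \<in> F" for H \<phi> X
    using packingD(2)[OF pack] that by blast
  have S_eq: "\<phi> = \<psi>" if "H \<in> Hs" "\<phi> \<in> S H" "\<psi> \<in> S H" "X \<in> F" "Y \<in> F" "\<phi> X \<subseteq> \<psi> Y" for H \<phi> \<psi> X Y
    using packingD(6)[OF pack] that by blast
  have A_sub: "A \<subseteq> {1..n-k}" "card A = a" "finite A" if "A \<in> \<A>" for A
    using that finite_subset by (auto simp: \<A>_def)
  have F_sub: "X \<subseteq> {1..k}" if "X \<in> F" for X using that F by blast

  have cases: "(\<exists>H\<in>Hs. \<exists>\<phi>\<in>S H. \<chi> = ext H \<phi>) \<or> (\<exists>A\<in>\<A>. \<chi> = base A)" if "\<chi> \<in> S'" for \<chi>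
    using that by (auto simp: S'_def S1_def S2_def)

  have size: "\<chi> X \<subseteq> {1..n} \<and> T - (\<rho> (tr (\<chi> X)) + 1) * D \<le> int (card (\<chi> X)) \<and>
      int (card (\<chi> X)) \<le> T - \<rho> (tr (\<chi> X)) * D"
    if "\<chi> \<in> S'" "X \<in> F" for \<chi> X
    using cases[OF that(1)]
  proof (elim disjE bexE)
    fix H \<phi> assume H: "H \<in> Hs" "\<phi> \<in> S H" "\<chi> = ext H \<phi>"
    have *: "H \<subseteq> {1..k}" "\<phi> X \<subseteq> {1..n-k}" using hole S_sub H that by auto
    have "T - \<rho> H * D - int (card H) - D \<le> int (card (\<phi> X))"
      "int (card (\<phi> X)) \<le> T - \<rho> H * D - int (card H)"
      using packingD(3,4)[OF pack[OF H(1)] H(2) that(2)] .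
    moreover have "H \<union> sh (\<phi> X) \<subseteq> {1..n}" using sh_sub[OF *(2)] *(1) k_n by blast
    ultimately show ?thesis
      unfolding H(3) ext_def tr_union[OF *] card_union[OF *] by (simp add: algebra_simps)
  next
    fix A assume A: "A \<in> \<A>" "\<chi> = base A"
    have *: "X \<subseteq> {1..k}" "A \<subseteq> {1..n-k}" using A_sub A F_sub that by auto
    have \<rho>: "\<rho> X = int k + 1" using that by (simp add: \<rho>_def trace_rank_def)
    have "card X \<le> k" using card_mono[OF _ *(1)] by simp
    moreover have "X \<union> sh A \<subseteq> {1..n}" using sh_sub[OF *(2)] *(1) k_n by blast
    ultimately show ?thesis
      unfolding A(2) base_def tr_union[OF *] card_union[OF *] \<rho>
      using a A_sub[OF A(1)] D by (simp add: algebra_simps)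
  qed

  \<comment> \<open>Windows of adjacent ranks share an endpoint, so a larger trace yields only
    \<open>card y \<le> card x\<close>. With \<open>x \<subseteq> y\<close> this forces
    \<open>x = y\<close>, against the traces being different.\<close>
  have sep: "tr x = tr y \<or> tr x \<in> F \<and> tr y \<in> F"
    if xy: "x \<subseteq> y" "y \<subseteq> {1..n}"
      and x: "T - (\<rho> (tr x) + 1) * D \<le> int (card x)" and y: "int (card y) \<le> T - \<rho> (tr y) * D" for x y
  proof (rule ccontr)
    assume neg: "\<not> ?thesis"
    moreover have "tr x \<subseteq> tr y" using xy by (auto simp: tr_def)
    ultimately have "tr x \<subset> tr y" by blast
    then have "trace_rank F k (tr x) < trace_rank F k (tr y)"
      using neg by (intro trace_rank_less[OF convex]) (auto simp: tr_def)
    then have "\<rho> (tr x) + 1 \<le> \<rho> (tr y)" by (simp add: \<rho>_def)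
    then have "(\<rho> (tr x) + 1) * D \<le> \<rho> (tr y) * D" using D by (intro mult_right_mono) auto
    then have "card y \<le> card x" using x y by linarith
    then have "x = y" using xy finite_subset card_seteq by (metis finite_atLeastAtMost)
    then show False using neg by simp
  qed

  have eq: "\<chi> = \<xi>" if \<chi>: "\<chi> \<in> S'" "\<xi> \<in> S'" "X \<in> F" "Y \<in> F" "\<chi> X \<subseteq> \<xi> Y" for \<chi> \<xi> X Y
  proof -
    have t: "tr (\<chi> X) = tr (\<xi> Y) \<or> tr (\<chi> X) \<in> F \<and> tr (\<xi> Y) \<in> F"
      using sep[of "\<chi> X" "\<xi> Y"] size[of \<chi> X] size[of \<xi> Y] \<chi> by blast
    have tr_ext: "tr (ext H \<phi> X) = H" if "H \<in> Hs" "\<phi> \<in> S H" "X \<in> F" for H \<phi> X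
      unfolding ext_def using that hole S_sub by (intro tr_union) auto
    have tr_base: "tr (base A X) = X" if "A \<in> \<A>" "X \<in> F" for A X
      unfolding base_def using that F_sub A_sub by (intro tr_union) auto
    \<comment> \<open>Two maps over holes have traces outside \<open>F\<close>, hence the same hole,
      whose packing decides. A mixed pair has exactly one trace in \<open>F\<close>, contradicting
      \<open>t\<close>. For two \<open>base\<close> maps, \<open>A \<subseteq> B\<close> and equal
      sizes give \<open>A = B\<close>.\<close>
    from cases[OF \<chi>(1)] cases[OF \<chi>(2)] show ?thesis
    proof (elim disjE bexE)
      fix H \<phi> G \<psi> assume H: "H \<in> Hs" "\<phi> \<in> S H" "\<chi> = ext H \<phi>" and G: "G \<in> Hs" "\<psi> \<in> S G" "\<xi> = ext G \<psi>"
      have "H = G" using t H G tr_ext \<chi> hole by metis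
      have "\<phi> X \<subseteq> \<psi> Y"
        using \<chi>(5) unfolding H(3) G(3) ext_def
        using sub_union[of H "\<phi> X" G "\<psi> Y"] hole S_sub H G \<chi> by blast
      then show ?thesis using S_eq[of H \<phi> \<psi> X Y] H G \<chi> \<open>H = G\<close> by blast
    next
      fix H \<phi> A assume H: "H \<in> Hs" "\<phi> \<in> S H" "\<chi> = ext H \<phi>" and A: "A \<in> \<A>" "\<xi> = base A"
      then show ?thesis using t tr_ext tr_base \<chi> hole by metis
    next
      fix H \<phi> A assume A: "A \<in> \<A>" "\<chi> = base A" and H: "H \<in> Hs" "\<phi> \<in> S H" "\<xi> = ext H \<phi>"
      then show ?thesis using t tr_ext tr_base \<chi> hole by metis
    next
      fix A B assume A: "A \<in> \<A>" "\<chi> = base A" and B: "B \<in> \<A>" "\<xi> = base B"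
      have "A \<subseteq> B"
        using \<chi>(5) unfolding A(2) B(2) base_def
        using sub_union[of X A Y B] A_sub A B \<chi> F_sub by blast
      then have "A = B" using A_sub A B by (metis card_subset_eq)
      then show ?thesis using A B by simp
    qed
  qed

  have fin: "finite S'"
  proof -
    have "finite \<A>" by (rule finite_subset[of _ "Pow {1..n-k}"]) (auto simp: \<A>_def)
    moreover have "finite Hs" by (simp add: Hs_def)
    ultimately show ?thesis using packingD(1)[OF pack] by (simp add: S'_def S1_def S2_def)
  qed

  have order: "\<chi> X \<subseteq> \<chi> Y \<longleftrightarrow> X \<subseteq> Y" if \<chi>: "\<chi> \<in> S'" "X \<in> F" "Y \<in> F" for \<chi> X Y
    using cases[OF \<chi>(1)]
  proof (elim disjE bexE)
    fix H \<phi> assume H: "H \<in> Hs" "\<phi> \<in> S H" "\<chi> = ext H \<phi>"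
    have "\<phi> X \<subseteq> \<phi> Y \<longleftrightarrow> X \<subseteq> Y"
      using packingD(5)[OF pack[OF H(1)] H(2) \<chi>(2,3)] .
    then show ?thesis
      unfolding H(3) ext_def using sub_union[of H "\<phi> X" H "\<phi> Y"] hole S_sub H \<chi> by blast
  next
    fix A assume A: "A \<in> \<A>" "\<chi> = base A"
    then show ?thesis
      unfolding A(2) base_def using sub_union[of X A Y A] A_sub \<chi> F_sub by blast
  qed

  have "packing F n (T - (2 * int k + 3) * D) T S'"
  proof -
    have bounds: "T - (2 * int k + 3) * D \<le> int (card (\<chi> X)) \<and> int (card (\<chi> X)) \<le> T"
      if "\<chi> \<in> S'" "X \<in> F" for \<chi> X
    proof -
      \<comment> \<open>Ranks run from 0 to \<open>2 * k + 2\<close>, which accounts for the factor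
        \<open>2 * k + 3\<close>.\<close>
      have "\<rho> (tr (\<chi> X)) + 1 \<le> 2 * int k + 3" "0 \<le> \<rho> (tr (\<chi> X))"
        using trace_rank_le[of "tr (\<chi> X)" k F] by (auto simp: \<rho>_def tr_def)
      then have "(\<rho> (tr (\<chi> X)) + 1) * D \<le> (2 * int k + 3) * D" "0 \<le> \<rho> (tr (\<chi> X)) * D"
        using D by (auto intro!: mult_right_mono)
      then show ?thesis using size[OF that] by linarith
    qed
    show ?thesis
      unfolding packing_def
    proof (intro conjI ballI impI)
      fix \<chi> \<xi> X Y assume "\<chi> \<in> S'" "\<xi> \<in> S'" "X \<in> F" "Y \<in> F" "\<chi> X \<subseteq> \<xi> Y"
      then show "\<chi> = \<xi>" by (rule eq)
    qed (simp_all add: fin size bounds order del: One_nat_def)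
  qed
  moreover have "card S' = (\<Sum>H\<in>Hs. card (S H)) + ((n - k) choose a)"
  proof -
    \<comment> \<open>One argument \<open>X\<close> tells all maps apart: the trace of the value is
      \<open>H\<close> for \<open>ext H\<close> and \<open>X\<close> itself for \<open>base\<close>,
      and within each class the value at \<open>X\<close> determines the map.\<close>
    obtain X where X: "X \<in> F" using F by blast
    have ext_at: "tr (ext H \<phi> X) = H" if "H \<in> Hs" "\<phi> \<in> S H" for H \<phi>
      unfolding ext_def using that hole S_sub X by (intro tr_union) auto
    have base_at: "tr (base A X) = X" if "A \<in> \<A>" for A
      unfolding base_def using that X F_sub A_sub by (intro tr_union) auto
    have inj1: "inj_on (ext H) (S H)" if "H \<in> Hs" for H
    proof (rule inj_onI)
      fix \<phi> \<psi> assume *: "\<phi> \<in> S H" "\<psi> \<in> S H" "ext H \<phi> = ext H \<psi>"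
      then have "H \<union> sh (\<phi> X) \<subseteq> H \<union> sh (\<psi> X)" by (auto simp: ext_def fun_eq_iff)
      then have "\<phi> X \<subseteq> \<psi> X"
        using sub_union[of H "\<phi> X" H "\<psi> X"] hole[OF that] S_sub[OF that _ X] * by blast
      then show "\<phi> = \<psi>" using S_eq that * X by blast
    qed
    have inj2: "inj_on base \<A>"
    proof (rule inj_onI)
      fix A B assume *: "A \<in> \<A>" "B \<in> \<A>" "base A = base B"
      then have "X \<union> sh A = X \<union> sh B" by (metis base_def)
      then show "A = B"
        using sub_union[of X A X B] sub_union[of X B X A] A_sub(1) * F_sub[OF X] by blast
    qed
    have fin1: "finite (S1 H)" if "H \<in> Hs" for H
      using packingD(1)[OF pack[OF that]] by (simp add: S1_def)
    have "(\<Union>H\<in>Hs. S1 H) \<inter> S2 = {}"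
    proof -
      have False if "H \<in> Hs" "\<phi> \<in> S H" "A \<in> \<A>" "base A = ext H \<phi>" for H \<phi> A
        using ext_at[of H \<phi>] base_at[of A] that hole X by metis
      then show ?thesis by (auto simp: S1_def S2_def)
    qed
    moreover have "card (\<Union>H\<in>Hs. S1 H) = (\<Sum>H\<in>Hs. card (S1 H))"
    proof (rule card_UN_disjoint)
      show "\<forall>i\<in>Hs. \<forall>j\<in>Hs. i \<noteq> j \<longrightarrow> S1 i \<inter> S1 j = {}"
      proof -
        have "H = G" if "H \<in> Hs" "G \<in> Hs" "\<phi> \<in> S H" "\<psi> \<in> S G" "ext H \<phi> = ext G \<psi>" for H G \<phi> \<psi>
          using ext_at that by metis
        then show ?thesis by (fastforce simp: S1_def)
      qed
    qed (use fin1 in \<open>auto simp: Hs_def\<close>)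
    moreover have "card (S1 H) = card (S H)" if "H \<in> Hs" for H
      using inj1[OF that] by (simp add: S1_def card_image)
    moreover have "card S2 = (n - k) choose a"
      using inj2 n_subsets[of "{1..n-k}" a] by (simp add: S2_def card_image \<A>_def)
    moreover have "finite (\<Union>H\<in>Hs. S1 H)" "finite S2" using fin by (auto simp: S'_def)
    ultimately show ?thesis by (simp add: S'_def card_Un_disjoint)
  qed
  ultimately show ?thesis unfolding Hs_def by blast
qed

section \<open>Growth of the density\<close>

text \<open>The iteration starts here: the required number of copies is not positive, so the empty
  packing serves.\<close>

lemma packing_density_0: "packing_density F 0"
proof -
  have "packing F n (T - 0) T {}" for n T by (simp add: packing_def)
  moreover have "(0 - \<delta>) * real (n choose (n div 2)) \<le> real (card {})" if "\<delta> > 0" for \<delta> n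
    using that by simp
  ultimately show ?thesis
    unfolding packing_density_def
    by (intro exI[of _ 0] allI impI always_eventually exI[of _ "{}"] conjI) auto
qed

lemma packing_mono:
  assumes "packing F n lo hi S" "lo' \<le> lo"
  shows "packing F n lo' hi S"
  using assms by (fastforce simp: packing_def)

text \<open>Each of the \<open>2 ^ k - card F\<close> holes contributes at least
  \<open>(c - \<delta>) * C'\<close> copies and the layer over \<open>F\<close> at least
  \<open>(1 - \<delta>) * C'\<close>, where \<open>C'\<close> is the central coefficient for
  \<open>n - k\<close> and at least \<open>2 ^ k\<close> times smaller than the one for
  \<open>n\<close> at worst.\<close>

lemma packing_density_step:
  assumes F: "F \<subseteq> Pow {1..k}" "F \<noteq> {}"
    and convex: "\<And>X Y Z. X \<in> F \<Longrightarrow> Z \<in> F \<Longrightarrow> X \<subseteq> Y \<Longrightarrow> Y \<subseteq> Z \<Longrightarrow> Y \<in> F"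
    and c: "packing_density F c"
  shows "packing_density F ((1 + (2 ^ k - real (card F)) * c) / 2 ^ k)"
proof -
  obtain D0 where D0: "\<And>Z \<delta>. \<delta> > 0 \<Longrightarrow> \<forall>\<^sub>F n in sequentially. \<forall>T::int. \<bar>2 * T - int n\<bar> \<le> Z \<longrightarrow>
     (\<exists>S. packing F n (T - D0) T S \<and> real (card S) \<ge> (c - \<delta>) * real (n choose (n div 2)))"
    using c unfolding packing_density_def by blast
  \<comment> \<open>\<open>packing_step\<close> requires \<open>D \<ge> int k\<close>; windows of
    width \<open>D0\<close> may be widened by \<open>packing_mono\<close>.\<close>
  define D where "D = max D0 (int k)"
  have D: "D \<ge> int k" "D \<ge> D0" by (simp_all add: D_def)
  show ?thesis
    unfolding packing_density_def
  proof (intro exI[of _ "(2 * int k + 3) * D"] allI impI)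
    fix Z :: int and \<delta> :: real assume \<delta>: "\<delta> > 0"
    \<comment> \<open>Tops drop by at most \<open>(2 * k + 2) * D + k\<close> and \<open>n\<close>
      drops by \<open>k\<close>; \<open>Z'\<close> leaves room for twice the first plus the
      second.\<close>
    define Z' where "Z' = \<bar>Z\<bar> + 2 * ((2 * int k + 3) * D) + 4 * int k"
    have "\<forall>\<^sub>F n in sequentially. (\<forall>T::int. \<bar>2 * T - int n\<bar> \<le> Z' \<longrightarrow>
        (\<exists>S. packing F n (T - D0) T S \<and> real (card S) \<ge> (c - \<delta>) * real (n choose (n div 2)))) \<and>
        (\<forall>T::int. \<bar>2 * T - int n\<bar> \<le> Z' \<longrightarrow>
          0 \<le> T \<and> real (n choose nat T) \<ge> (1 - \<delta>) * real (n choose (n div 2)))"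
      by (intro eventually_conj D0 near_central_binomial \<delta>)
    then obtain N where N: "\<And>n T. n \<ge> N \<Longrightarrow> \<bar>2 * T - int n\<bar> \<le> Z' \<Longrightarrow>
        \<exists>S. packing F n (T - D0) T S \<and> real (card S) \<ge> (c - \<delta>) * real (n choose (n div 2))"
      "\<And>n T. n \<ge> N \<Longrightarrow> \<bar>2 * T - int n\<bar> \<le> Z' \<Longrightarrow>
        0 \<le> T \<and> real (n choose nat T) \<ge> (1 - \<delta>) * real (n choose (n div 2))"
      unfolding eventually_sequentially by blast
    show "\<forall>\<^sub>F n in sequentially. \<forall>T::int. \<bar>2 * T - int n\<bar> \<le> Z \<longrightarrow>
      (\<exists>S. packing F n (T - (2 * int k + 3) * D) T S \<and>
        real (card S) \<ge> ((1 + (2 ^ k - real (card F)) * c) / 2 ^ k - \<delta>) * real (n choose (n div 2)))"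
    proof (rule eventually_sequentiallyI[of "N + k"], intro allI impI)
      fix n T assume n: "N + k \<le> n" and T: "\<bar>2 * T - int n\<bar> \<le> Z"
      define Hs where "Hs = Pow {1..k} - F"
      define TH where "TH = (\<lambda>H. T - int (trace_rank F k H) * D - int (card H))"
      define C where "C = real (n choose (n div 2))"
      define C' where "C' = real ((n - k) choose ((n - k) div 2))"
      have n': "N \<le> n - k" "k \<le> n" using n by auto
      have near: "\<bar>2 * (T - r * D - h) - int (n - k)\<bar> \<le> Z'"
        if "0 \<le> r" "r \<le> 2 * int k + 2" "0 \<le> h" "h \<le> int k" for r h
      proof -
        have "0 \<le> r * D" "r * D \<le> (2 * int k + 3) * D"
          using that D by (auto intro!: mult_right_mono)
        moreover have "int (n - k) = int n - int k" using n' by (simp add: of_nat_diff)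
        ultimately show ?thesis
          using T that unfolding Z'_def right_diff_distrib by linarith
      qed
      have "\<exists>S. packing F (n - k) (TH H - D) (TH H) S \<and> real (card S) \<ge> (c - \<delta>) * C'" if "H \<in> Hs" for H
      proof -
        have H: "H \<subseteq> {1..k}" using that by (simp add: Hs_def)
        have "\<bar>2 * TH H - int (n - k)\<bar> \<le> Z'"
          unfolding TH_def using trace_rank_le[OF H, of F] card_mono[OF _ H] by (intro near) auto
        from N(1)[OF n'(1) this] obtain S where
          "packing F (n - k) (TH H - D0) (TH H) S" "real (card S) \<ge> (c - \<delta>) * C'"
          unfolding C'_def by blast
        then show ?thesis using packing_mono[of F "n - k" "TH H - D0" "TH H" S "TH H - D"] D by auto
      qed
      then obtain S where S: "\<And>H. H \<in> Hs \<Longrightarrow> packing F (n - k) (TH H - D) (TH H) (S H)"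
        "\<And>H. H \<in> Hs \<Longrightarrow> real (card (S H)) \<ge> (c - \<delta>) * C'" by metis
      \<comment> \<open>The eventual bound \<open>N(2)\<close> includes nonnegativity, so
        \<open>nat\<close> loses nothing.\<close>
      define a where "a = nat (T - (int k + 1) * D - int k)"
      have a: "int a = T - (int k + 1) * D - int k" "real ((n - k) choose a) \<ge> (1 - \<delta>) * C'"
        using N(2)[OF n'(1) near[of "int k + 1" "int k"]] by (simp_all add: a_def C'_def)
      have "\<exists>S'. packing F n (T - (2 * int k + 3) * D) T S' \<and>
        card S' = (\<Sum>H\<in>Hs. card (S H)) + ((n - k) choose a)"
        unfolding Hs_def
      proof (rule packing_step[OF F _ n'(2) D(1) a(1)])
        show "Y \<in> F" if "X \<in> F" "Z \<in> F" "X \<subseteq> Y" "Y \<subseteq> Z" for X Y Z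
          using that by (rule convex)
        show "packing F (n - k) (T - int (trace_rank F k H) * D - int (card H) - D)
            (T - int (trace_rank F k H) * D - int (card H)) (S H)" if "H \<in> Pow {1..k} - F" for H
          using S(1)[unfolded Hs_def TH_def, OF that] .
      qed
      then obtain S' where S': "packing F n (T - (2 * int k + 3) * D) T S'"
        "card S' = (\<Sum>H\<in>Hs. card (S H)) + ((n - k) choose a)"
        by blast
      have cF: "card F \<le> 2 ^ k" using card_mono[OF _ F(1)] by (simp add: card_Pow)
      have cHs: "real (card Hs) = 2 ^ k - real (card F)"
        using F(1) cF finite_subset[OF F(1)] by (simp add: Hs_def card_Diff_subset card_Pow of_nat_diff)
      have CC': "C \<le> 2 ^ k * C'"
        using central_binomial_half[of n k] unfolding C_def C'_def
        by (metis of_nat_le_iff of_nat_mult of_nat_numeral of_nat_power)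
      \<comment> \<open>The factor \<open>x\<close> will be \<open>c - \<delta>\<close> or
        \<open>1 - \<delta>\<close>, which may be negative. Then \<open>C'\<close> cannot be traded
        for \<open>C / 2 ^ k\<close>, but the left side is at most 0 anyway.\<close>
      have mono: "x / 2 ^ k * C \<le> y" if "x * C' \<le> y" "0 \<le> y" for x y
      proof (cases "x \<ge> 0")
        case True
        then have "x * C \<le> x * (2 ^ k * C')" using CC' by (intro mult_left_mono)
        then have "x / 2 ^ k * C \<le> x * C'" by (simp add: field_simps)
        then show ?thesis using that by linarith
      next
        case False
        then have "x / 2 ^ k * C \<le> 0" by (simp add: C_def mult_nonpos_nonneg divide_nonpos_nonneg)
        then show ?thesis using that by linarith
      qed
      have "((1 + (2 ^ k - real (card F)) * c) / 2 ^ k - \<delta>) * C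
        \<le> ((1 + (2 ^ k - real (card F)) * c) / 2 ^ k - \<delta> * (1 + (2 ^ k - real (card F))) / 2 ^ k) * C"
      proof -
        \<comment> \<open>With at least one trace in \<open>F\<close>, at most \<open>2 ^ k\<close>
          errors \<open>\<delta> / 2 ^ k\<close> add up, so the same \<open>\<delta>\<close> serves
          before and after the step.\<close>
        have "card F \<ge> 1" using F finite_subset[OF F(1)] by (simp add: Suc_le_eq card_gt_0_iff)
        then have "\<delta> * (1 + (2 ^ k - real (card F))) / 2 ^ k \<le> \<delta>"
          using \<delta> by (simp add: field_simps)
        then show ?thesis by (intro mult_right_mono) (auto simp: C_def)
      qed
      also have "\<dots> = (2 ^ k - real (card F)) * ((c - \<delta>) / 2 ^ k * C) + (1 - \<delta>) / 2 ^ k * C"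
        by (simp add: field_simps)
      also have "\<dots> = (\<Sum>H\<in>Hs. (c - \<delta>) / 2 ^ k * C) + (1 - \<delta>) / 2 ^ k * C"
        by (simp only: sum_constant cHs)
      also have "\<dots> \<le> (\<Sum>H\<in>Hs. real (card (S H))) + real ((n - k) choose a)"
        by (intro add_mono sum_mono mono S(2) a(2)) auto
      also have "\<dots> = real (card S')" by (simp add: S'(2))
      finally show "\<exists>S. packing F n (T - (2 * int k + 3) * D) T S \<and>
        real (card S) \<ge> ((1 + (2 ^ k - real (card F)) * c) / 2 ^ k - \<delta>) * real (n choose (n div 2))"
        using S'(1) unfolding C_def by blast
    qed
  qed
qed

text \<open>With \<open>q\<close> the proportion of traces outside \<open>F\<close>, the step is the
  affine map taking \<open>c\<close> to \<open>(1 - q) / t + q * c\<close>, with fixed point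
  \<open>1 / t\<close>. Its iterates from 0 are \<open>(1 - q ^ i) / t\<close>, and
  \<open>q < 1\<close>.\<close>

lemma packing_density_inverse_card:
  assumes F: "F \<subseteq> Pow {1..k}" "F \<noteq> {}"
    and convex: "\<And>X Y Z. X \<in> F \<Longrightarrow> Z \<in> F \<Longrightarrow> X \<subseteq> Y \<Longrightarrow> Y \<subseteq> Z \<Longrightarrow> Y \<in> F"
    and e: "e > 0"
  shows "\<forall>\<^sub>F n in sequentially. \<exists>lo hi S. packing F n lo hi S \<and>
    real (card S) \<ge> (1 / real (card F) - e) * real (n choose (n div 2))"
proof -
  define t where "t = real (card F)"
  define q where "q = (2 ^ k - t) / 2 ^ k"
  have "card F \<le> 2 ^ k" using card_mono[OF _ F(1)] by (simp add: card_Pow)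
  then have "t \<le> 2 ^ k" unfolding t_def by (metis of_nat_le_iff of_nat_numeral of_nat_power)
  moreover have "t > 0"
    using F finite_subset[OF F(1)] by (simp add: t_def card_gt_0_iff)
  ultimately have t: "t > 0" and q: "0 \<le> q" "q < 1" by (auto simp: q_def field_simps)
  have dens: "packing_density F ((1 - q ^ i) / t)" for i
  proof (induction i)
    case 0 show ?case using packing_density_0 by simp
  next
    case (Suc i)
    have "(1 + (2 ^ k - t) * ((1 - q ^ i) / t)) / 2 ^ k = (1 - q) / t + q * ((1 - q ^ i) / t)"
      using t by (simp add: q_def field_simps)
    also have "\<dots> = (1 - q ^ Suc i) / t" using t by (simp add: field_simps)
    finally show ?case using packing_density_step[OF F convex Suc] by (simp add: t_def)
  qed
  \<comment> \<open>Half of \<open>e\<close> covers the distance \<open>q ^ i / t\<close> to the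
    fixed point, the other half is the \<open>\<delta>\<close> of the density.\<close>
  obtain i where i: "q ^ i < e * t / 2"
    using real_arch_pow_inv[of "e * t / 2" q] e t q by auto
  from dens[of i] obtain D where "\<forall>\<^sub>F n in sequentially. \<forall>T::int. \<bar>2 * T - int n\<bar> \<le> 1 \<longrightarrow>
     (\<exists>S. packing F n (T - D) T S \<and> real (card S) \<ge> ((1 - q ^ i) / t - e / 2) * real (n choose (n div 2)))"
    unfolding packing_density_def using half_gt_zero[OF e] by blast
  then show ?thesis
  proof eventually_elim
    case (elim n)
    \<comment> \<open>The top is \<open>n div 2\<close>; the bound 1 allows for odd
      \<open>n\<close>.\<close>
    have "\<bar>2 * int (n div 2) - int n\<bar> \<le> 1" by linarith
    then obtain S where S: "packing F n (int (n div 2) - D) (int (n div 2)) S"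
      "real (card S) \<ge> ((1 - q ^ i) / t - e / 2) * real (n choose (n div 2))"
      using elim by blast
    have "1 / t - e \<le> (1 - q ^ i) / t - e / 2" using i t by (simp add: field_simps)
    then have "(1 / t - e) * real (n choose (n div 2)) \<le> ((1 - q ^ i) / t - e / 2) * real (n choose (n div 2))"
      by (intro mult_right_mono) auto
    then have "(1 / t - e) * real (n choose (n div 2)) \<le> real (card S)" using S(2) by linarith
    then show ?case using S(1) unfolding t_def by blast
  qed
qed

section \<open>Copies of a poset from a packing\<close>

text \<open>The two cases differ only in the class of maps, so both are derived for an arbitrary class
  \<open>E\<close> closed under composition with order isomorphisms onto the image.\<close>

lemma Max_incomparable_copies_ge:
  fixes E :: "nat \<Rightarrow> ('a \<Rightarrow> nat set) \<Rightarrow> bool"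
  assumes P: "P \<noteq> {}" and emb: "E k f" "f ` P \<subseteq> Pow {1..k}"
    and sub: "\<And>n g. E n g \<Longrightarrow> g ` P \<subseteq> Pow {1..n}"
    and comp: "\<And>n \<phi>. (\<And>X. X \<in> conv k (f ` P) \<Longrightarrow> \<phi> X \<subseteq> {1..n}) \<Longrightarrow>
      (\<And>X Y. X \<in> f ` P \<Longrightarrow> Y \<in> f ` P \<Longrightarrow> \<phi> X \<subseteq> \<phi> Y \<longleftrightarrow> X \<subseteq> Y) \<Longrightarrow> E n (\<phi> \<circ> f)"
    and \<epsilon>: "\<epsilon> > 0"
  shows "\<forall>\<^sub>F n in sequentially.
    1 / real (card (conv k (f ` P))) * real (n choose (n div 2)) * (1 - \<epsilon>) \<le>
    real (Max {M. \<exists>g :: nat \<Rightarrow> 'a \<Rightarrow> nat set. (\<forall>i\<in>{1..M}. E n (g i)) \<and>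
      (\<forall>i\<in>{1..M}. \<forall>j\<in>{1..M}. i \<noteq> j \<longrightarrow> incomparable (g i ` P) (g j ` P))})"
proof -
  define F where "F = conv k (f ` P)"
  have fF: "f ` P \<subseteq> F" using emb(2) by (auto simp: F_def conv_def)
  have F: "F \<subseteq> Pow {1..k}" "F \<noteq> {}" using fF P by (force simp: F_def conv_def, blast)
  have convex: "Y \<in> F" if XYZ: "X \<in> F" "Z \<in> F" "X \<subseteq> Y" "Y \<subseteq> Z" for X Y Z
  proof -
    obtain a c where ac: "a \<in> f ` P" "a \<subseteq> X" "c \<in> f ` P" "Z \<subseteq> c"
      using XYZ(1,2) unfolding F_def conv_def by blast
    have "Y \<in> Pow {1..k}" using XYZ F by blast
    moreover have "a \<subseteq> Y" "Y \<subseteq> c" using ac XYZ by blast+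
    ultimately show ?thesis using ac(1,3) unfolding F_def conv_def by blast
  qed
  have t: "real (card F) > 0" using F finite_subset[OF F(1)] by (simp add: card_gt_0_iff)
  obtain p where p: "p \<in> P" using P by blast
  have "\<forall>\<^sub>F n in sequentially. \<exists>lo hi S. packing F n lo hi S \<and>
    real (card S) \<ge> (1 / real (card F) - \<epsilon> / real (card F)) * real (n choose (n div 2))"
    using t \<epsilon> by (intro packing_density_inverse_card[OF F]) (auto intro: convex)
  then show ?thesis
  proof eventually_elim
    case (elim n)
    let ?A = "{M. \<exists>g :: nat \<Rightarrow> 'a \<Rightarrow> nat set. (\<forall>i\<in>{1..M}. E n (g i)) \<and>
      (\<forall>i\<in>{1..M}. \<forall>j\<in>{1..M}. i \<noteq> j \<longrightarrow> incomparable (g i ` P) (g j ` P))}"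
    obtain lo hi S where S: "packing F n lo hi S"
      "real (card S) \<ge> (1 / real (card F) - \<epsilon> / real (card F)) * real (n choose (n div 2))"
      using elim by blast
    \<comment> \<open>\<open>Max\<close> is informative only for a finite set. Incomparability makes
      the values at the one point \<open>p\<close> distinct, so there are at most
      \<open>2 ^ n\<close> copies.\<close>
    have "?A \<subseteq> {..2 ^ n}"
    proof
      fix M assume "M \<in> ?A"
      then obtain g :: "nat \<Rightarrow> 'a \<Rightarrow> nat set" where g: "\<And>i. i \<in> {1..M} \<Longrightarrow> E n (g i)"
        "\<And>i j. i \<in> {1..M} \<Longrightarrow> j \<in> {1..M} \<Longrightarrow> i \<noteq> j \<Longrightarrow> incomparable (g i ` P) (g j ` P)"
        by blast
      have "inj_on (\<lambda>i. g i p) {1..M}"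
      proof (rule inj_onI)
        fix i j assume ij: "i \<in> {1..M}" "j \<in> {1..M}" "g i p = g j p"
        show "i = j"
        proof (rule ccontr)
          assume "i \<noteq> j"
          from g(2)[OF ij(1,2) this] show False using p ij(3) by (auto simp: incomparable_def)
        qed
      qed
      moreover have "(\<lambda>i. g i p) ` {1..M} \<subseteq> Pow {1..n}" using sub[OF g(1)] p by blast
      ultimately have "card {1..M} \<le> card (Pow {1..n})" by (intro card_inj_on_le) auto
      then show "M \<in> {..2 ^ n}" by (simp add: card_Pow)
    qed
    then have fin: "finite ?A" using finite_subset by blast
    obtain h where h: "bij_betw h {1..card S} S"
      using ex_bij_betw_nat_finite_1[OF packingD(1)[OF S(1)]] by blast
    have "E n (h i \<circ> f)" if "i \<in> {1..card S}" for i
    proof (rule comp)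
      have hi: "h i \<in> S" using h that by (auto simp: bij_betw_def)
      show "h i X \<subseteq> {1..n}" if "X \<in> conv k (f ` P)" for X
        using packingD(2)[OF S(1) hi, of X] that by (simp add: F_def)
      show "h i X \<subseteq> h i Y \<longleftrightarrow> X \<subseteq> Y" if "X \<in> f ` P" "Y \<in> f ` P" for X Y
        using packingD(5)[OF S(1) hi, of X Y] that fF by blast
    qed
    moreover have "incomparable ((h i \<circ> f) ` P) ((h j \<circ> f) ` P)"
      if ij: "i \<in> {1..card S}" "j \<in> {1..card S}" "i \<noteq> j" for i j
    proof -
      have hS: "h i \<in> S" "h j \<in> S" using bij_betw_apply[OF h] ij by blast+
      have neq: "h i \<noteq> h j" using bij_betw_imp_inj_on[OF h] ij by (metis inj_on_contraD)
      have "\<not> h i X \<subseteq> h j Y \<and> \<not> h j Y \<subseteq> h i X" if "X \<in> F" "Y \<in> F" for X Y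
        using packingD(6)[OF S(1) hS that] packingD(6)[OF S(1) hS(2,1) that(2,1)] neq by metis
      then show ?thesis using fF unfolding incomparable_def image_comp[symmetric] by blast
    qed
    ultimately have "card S \<in> ?A" by (intro CollectI exI[of _ "\<lambda>i. h i \<circ> f"]) blast
    then have "real (card S) \<le> real (Max ?A)" using Max_ge[OF fin] by simp
    \<comment> \<open>The absolute error \<open>\<epsilon> / card F\<close> is the relative error
      \<open>\<epsilon>\<close>.\<close>
    moreover have "1 / real (card F) * real (n choose (n div 2)) * (1 - \<epsilon>)
      = (1 / real (card F) - \<epsilon> / real (card F)) * real (n choose (n div 2))"
      by (simp add: algebra_simps diff_divide_distrib)
    ultimately show ?case using S(2) unfolding F_def by linarith
  qed
qed

section \<open>Existence of embeddings and optimal hulls\<close>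

text \<open>Each element goes to its principal down-set, with \<open>P\<close> numbered by
  \<open>{1..card P}\<close>. This ensures that the minima \<open>t1\<close> and \<open>t2\<close>
  are attained.\<close>

lemma ex_induced_embedding:
  assumes "finite P" "partial_order_on P r"
  shows "\<exists>n f. induced_embedding P r n f"
proof -
  obtain g where g: "bij_betw g P {1..card P}"
    using ex_bij_betw_finite_nat[OF assms(1)] ex_bij_betw_nat_finite_1[OF assms(1)] bij_betw_inv by blast
  define f where "f = (\<lambda>a. g ` {b \<in> P. (b, a) \<in> r})"
  have refl: "(a, a) \<in> r" if "a \<in> P" for a
    using assms(2) that by (auto simp: partial_order_on_def preorder_on_def refl_on_def)
  have trans: "trans r" and antisym: "antisym r"
    using assms(2) by (auto simp: partial_order_on_def preorder_on_def)
  have mem: "g c \<in> f b \<longleftrightarrow> (c, b) \<in> r" if "c \<in> P" for b c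
    using inj_on_image_mem_iff[OF bij_betw_imp_inj_on[OF g] that, of "{c \<in> P. (c, b) \<in> r}"] that
    unfolding f_def by blast
  have le: "f a \<subseteq> f b \<longleftrightarrow> (a, b) \<in> r" if "a \<in> P" "b \<in> P" for a b
  proof -
    have "f a \<subseteq> f b \<longleftrightarrow> {c \<in> P. (c, a) \<in> r} \<subseteq> {c \<in> P. (c, b) \<in> r}"
      using mem unfolding image_subset_iff f_def by blast
    also have "\<dots> \<longleftrightarrow> (a, b) \<in> r"
      using refl trans that unfolding trans_def by blast
    finally show ?thesis .
  qed
  have eq: "a = b" if "a \<in> P" "b \<in> P" "f a = f b" for a b
    using that le[of a b] le[of b a] antisymD[OF antisym] by blast
  have "f ` P \<subseteq> Pow {1..card P}" using g by (auto simp: f_def bij_betw_def)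
  moreover have "inj_on f P" using eq by (auto intro: inj_onI)
  moreover have "\<forall>a\<in>P. \<forall>b\<in>P. f a \<subset> f b \<longleftrightarrow> (a, b) \<in> r \<and> a \<noteq> b"
    using le eq by (auto simp: psubset_eq)
  ultimately show ?thesis unfolding induced_embedding_def by blast
qed

lemma embedding_if_induced: "induced_embedding P r n f \<Longrightarrow> embedding P r n f"
  by (simp add: embedding_def induced_embedding_def)

lemma t1_attained:
  assumes "embedding P r n f"
  shows "\<exists>n f. embedding P r n f \<and> t1 P r = card (conv n (f ` P))"
  unfolding t1_def by (rule LeastI_ex) (use assms in blast)

lemma t2_attained:
  assumes "induced_embedding P r n f"
  shows "\<exists>n f. induced_embedding P r n f \<and> t2 P r = card (conv n (f ` P))"
  unfolding t2_def by (rule LeastI_ex) (use assms in blast)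

text \<open>This supplies the closure property \<open>comp\<close>: a map that preserves and
  reflects inclusion on the image is injective there by antisymmetry and respects proper
  inclusion.\<close>

lemma embedding_comp:
  assumes f: "embedding P r k f"
    and sub: "\<And>X. X \<in> conv k (f ` P) \<Longrightarrow> \<phi> X \<subseteq> {1..n}"
    and ord: "\<And>X Y. X \<in> f ` P \<Longrightarrow> Y \<in> f ` P \<Longrightarrow> \<phi> X \<subseteq> \<phi> Y \<longleftrightarrow> X \<subseteq> Y"
  shows "embedding P r n (\<phi> \<circ> f)"
proof -
  have "f ` P \<subseteq> conv k (f ` P)" using f by (auto simp: embedding_def conv_def)
  then have "(\<phi> \<circ> f) ` P \<subseteq> Pow {1..n}" using sub by (auto simp: image_subset_iff)
  moreover have "inj_on \<phi> (f ` P)" using ord by (intro inj_onI) (metis subset_antisym order_refl)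
  then have "inj_on (\<phi> \<circ> f) P" using f by (intro comp_inj_on) (auto simp: embedding_def)
  moreover have "\<phi> X \<subset> \<phi> Y \<longleftrightarrow> X \<subset> Y" if "X \<in> f ` P" "Y \<in> f ` P" for X Y
    using ord that by (simp add: less_le_not_le)
  ultimately show ?thesis using f by (simp add: embedding_def)
qed

lemma induced_embedding_comp:
  assumes f: "induced_embedding P r k f"
    and sub: "\<And>X. X \<in> conv k (f ` P) \<Longrightarrow> \<phi> X \<subseteq> {1..n}"
    and ord: "\<And>X Y. X \<in> f ` P \<Longrightarrow> Y \<in> f ` P \<Longrightarrow> \<phi> X \<subseteq> \<phi> Y \<longleftrightarrow> X \<subseteq> Y"
  shows "induced_embedding P r n (\<phi> \<circ> f)"
proof -
  have "embedding P r n (\<phi> \<circ> f)"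
    using embedding_comp[OF embedding_if_induced[OF f]] sub ord by blast
  moreover have "\<phi> X \<subset> \<phi> Y \<longleftrightarrow> X \<subset> Y" if "X \<in> f ` P" "Y \<in> f ` P" for X Y
    using ord that by (simp add: less_le_not_le)
  ultimately show ?thesis using f by (simp add: embedding_def induced_embedding_def)
qed

theorem theorem3:
  fixes P :: "'a set" and r :: "'a rel" and \<epsilon> :: real
  assumes "finite P" and "partial_order_on P r" and "\<epsilon> > 0"
  shows "(\<forall>\<^sub>F n in sequentially.
            real (M1 P r n) \<ge> 1 / real (t1 P r) * real (n choose (n div 2)) * (1 - \<epsilon>)) \<and>
         (\<forall>\<^sub>F n in sequentially.
            real (M2 P r n) \<ge> 1 / real (t2 P r) * real (n choose (n div 2)) * (1 - \<epsilon>))"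
proof -
  \<comment> \<open>An induced embedding is also an embedding, so one witness serves both minima,
    whose optimal embeddings \<open>f\<close> and \<open>g\<close> may differ.\<close>
  obtain n0 f0 where "induced_embedding P r n0 f0" using ex_induced_embedding[OF assms(1,2)] by blast
  then obtain k f l g where
    f: "embedding P r k f" "t1 P r = card (conv k (f ` P))" and
    g: "induced_embedding P r l g" "t2 P r = card (conv l (g ` P))"
    using t1_attained[OF embedding_if_induced] t2_attained by metis
  show ?thesis
  proof (cases "P = {}")
    case True
    \<comment> \<open>For empty \<open>P\<close> the hull is empty, and \<open>1 / 0 = 0\<close>
      turns both lower bounds into 0.\<close>
    then show ?thesis using f g by (simp add: conv_def)
  next
    case False
    have "\<forall>\<^sub>F n in sequentially.
        1 / real (t1 P r) * real (n choose (n div 2)) * (1 - \<epsilon>) \<le> real (M1 P r n)"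
      unfolding M1_def f(2)
    proof (rule Max_incomparable_copies_ge[OF False, where E = "embedding P r"])
      show "f ` P \<subseteq> Pow {1..k}" using f(1) unfolding embedding_def by blast
      show "h ` P \<subseteq> Pow {1..n}" if "embedding P r n h" for n h
        using that unfolding embedding_def by blast
      show "embedding P r n (\<phi> \<circ> f)"
        if "\<And>X. X \<in> conv k (f ` P) \<Longrightarrow> \<phi> X \<subseteq> {1..n}"
          "\<And>X Y. X \<in> f ` P \<Longrightarrow> Y \<in> f ` P \<Longrightarrow> \<phi> X \<subseteq> \<phi> Y \<longleftrightarrow> X \<subseteq> Y" for n \<phi>
        using f(1) that by (rule embedding_comp)
    qed (use f(1) assms(3) in auto)
    moreover have "\<forall>\<^sub>F n in sequentially.
        1 / real (t2 P r) * real (n choose (n div 2)) * (1 - \<epsilon>) \<le> real (M2 P r n)"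
      unfolding M2_def g(2)
    proof (rule Max_incomparable_copies_ge[OF False, where E = "induced_embedding P r"])
      show "g ` P \<subseteq> Pow {1..l}" using g(1) unfolding induced_embedding_def by blast
      show "h ` P \<subseteq> Pow {1..n}" if "induced_embedding P r n h" for n h
        using that unfolding induced_embedding_def by blast
      show "induced_embedding P r n (\<phi> \<circ> g)"
        if "\<And>X. X \<in> conv l (g ` P) \<Longrightarrow> \<phi> X \<subseteq> {1..n}"
          "\<And>X Y. X \<in> g ` P \<Longrightarrow> Y \<in> g ` P \<Longrightarrow> \<phi> X \<subseteq> \<phi> Y \<longleftrightarrow> X \<subseteq> Y" for n \<phi>
        using g(1) that by (rule induced_embedding_comp)
    qed (use g(1) assms(3) in auto)
    ultimately show ?thesis by simp
  qed
qed

end
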